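(* Let $\alpha: I\to E_1^3$ be a non-lightlike curve and let $\beta$ be a non-lightlike evolute-direction curve of $\alpha$. Then the following are equivalent: (i) $\alpha$ is a plane curve. (ii) $\alpha$ is an involute-donor curve of a helix. (iii) An evolute-direction curve of $\alpha$ is a helix.
   Context: $E_1^3$ is $\mathbb{R}^3$ with the metric $\langle x,y\rangle=-x_1y_1+x_2y_2+x_3y_3$ and the Lorentz vector product $x\times y=(x_2y_3-x_3y_2,\ x_1y_3-x_3y_1,\ x_2y_1-x_1y_2)$. A vector $x$ is spacelike if $\langle x,x\rangle>0$ or $x=0$, timelike if $\langle x,x\rangle<0$, lightlike if $\langle x,x\rangle=0$ and $x\ne0$. A curve is timelike (spacelike) if all its velocity vectors are; non-lightlike means timelike or spacelike; unit speed means $|\langle\alpha',\alpha'\rangle|=1$. All curves are unit speed Frenet curves, as differentiable as needed. A unit speed non-lightlike curve $\alpha(s)$ has Frenet frame $\{T,N,B\}$ (orthonormal, non-lightlike vectors, $T=\alpha'$), curvature $\kappa$ and torsion $\tau$ with $T'=\kappa N,\ N'=\varepsilon_B\kappa T+\tau B,\ B'=\varepsilon_T\tau N$, where $\varepsilon_Y=\langle Y,Y\rangle=\pm1$ and $\varepsilon_B=-\varepsilon_T\varepsilon_N$; the frame satisfies $B=\varepsilon_T\varepsilon_N T\times N$, $N=\varepsilon_B\varepsilon_T B\times T$, $T=\varepsilon_N\varepsilon_B N\times B$. It is a Frenet curve if $\kappa\neq0$. A spacelike curve is of type 1 if $N$ is timelike (and $T,B$ spacelike), of type 2 if $B$ is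 timelike (and $T,N$ spacelike). Let $X=uT+vN+wB$ with $u,v,w$ differentiable and $\varepsilon_Tu^2+\varepsilon_Nv^2+\varepsilon_Bw^2=\pm1$ (constant sign). An $X$-direction curve of $\alpha$ is a curve $\beta$ with tangent $\overline T=X$; $s$ is also arc-length for $\beta$. The Frenet frame, curvature and torsion of $\beta$ are $\{\overline T,\overline N,\overline B\},\overline\kappa,\overline\tau$, with $\overline\kappa\ne0$. $\beta$ is an evolute-direction curve of $\alpha$, and $\alpha$ an involute-donor curve of $\beta$, if $\beta$ is an $X$-direction curve of $\alpha$ and an evolute of $\alpha$ (i.e. $\langle\overline T,T\rangle=0$ and $\overline N=T$); explicitly, $X$ is: $-\cos(\int\tau ds)N+\sin(\int\tau ds)B$ if $\alpha$ is timelike and $X$ spacelike; $-\cosh(\int\tau ds)N+\sinh(\int\tau ds)B$ if $\alpha$ is spacelike of type 1 (resp. type 2) and $X$ timelike (resp. spacelike); $\sinh(\int\tau ds)N-\cosh(\int\tau ds)B$ if $\alpha$ is spacelike of type 1 (resp. type 2) and $X$ spacelike (resp. timelike), with $\int\tau\,ds$ an antiderivative of $\tau$. A (general) helix is a curve for which the ratio of its non-zero curvature to its non-zero torsion is a constant function. A plane curve is a curve lying in a plane (equivalently here, $\tau\equiv0$). *)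

theory Defs
  imports "HOL-Analysis.Analysis"
begin

text \<open>The Lorentz--Minkowski space \<open>E\<^sub>1\<^sup>3\<close> is the type \<^typ>\<open>real^3\<close> with the following scalar
  product and vector product.\<close>

definition lorentz :: "real^3 \<Rightarrow> real^3 \<Rightarrow> real"
  where "lorentz x y = - x$1 * y$1 + x$2 * y$2 + x$3 * y$3"

definition lorentz_cross :: "real^3 \<Rightarrow> real^3 \<Rightarrow> real^3"
  where "lorentz_cross x y =
    vector [x$2 * y$3 - x$3 * y$2, x$1 * y$3 - x$3 * y$1, x$2 * y$1 - x$1 * y$2]"

definition spacelike :: "real^3 \<Rightarrow> bool"
  where "spacelike x \<longleftrightarrow> lorentz x x > 0 \<or> x = 0"

definition timelike :: "real^3 \<Rightarrow> bool"
  where "timelike x \<longleftrightarrow> lorentz x x < 0"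

text \<open>Curves are functions on \<^typ>\<open>real\<close> of which only the values on the parameter interval \<open>I\<close>
  matter; all derivatives are taken within \<open>I\<close>, which makes sense also at end points of \<open>I\<close>
  when \<open>I\<close> is a nondegenerate interval.\<close>

abbreviation velocity :: "real set \<Rightarrow> (real \<Rightarrow> real^3) \<Rightarrow> real \<Rightarrow> real^3"
  where "velocity I \<alpha> s \<equiv> vector_derivative \<alpha> (at s within I)"

definition nonlightlike_curve :: "real set \<Rightarrow> (real \<Rightarrow> real^3) \<Rightarrow> bool"
  where "nonlightlike_curve I \<alpha> \<longleftrightarrow>
    (\<forall>s\<in>I. timelike (velocity I \<alpha> s)) \<or> (\<forall>s\<in>I. spacelike (velocity I \<alpha> s))"

definition unit_speed_curve :: "real set \<Rightarrow> (real \<Rightarrow> real^3) \<Rightarrow> bool"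
  where "unit_speed_curve I \<alpha> \<longleftrightarrow> (\<forall>s\<in>I. \<bar>lorentz (velocity I \<alpha> s) (velocity I \<alpha> s)\<bar> = 1)"

text \<open>\<open>frenet I \<alpha> T N B \<kappa> \<tau>\<close>: along the curve \<open>\<alpha>\<close>, \<open>{T, N, B}\<close> is a Frenet frame with curvature
  \<open>\<kappa>\<close> and torsion \<open>\<tau>\<close>, where \<open>\<kappa>\<close> vanishes nowhere. The numbers \<open>eT\<close>, \<open>eN\<close>, \<open>eB\<close> are the signs
  \<open>\<epsilon>\<^sub>T\<close>, \<open>\<epsilon>\<^sub>N\<close>, \<open>\<epsilon>\<^sub>B\<close>. The curvature is signed, so that \<open>(T, N, B, \<kappa>, \<tau>)\<close> and \<open>(T, -N, -B, -\<kappa>, \<tau>)\<close>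
  are both admissible, and these are the only possibilities if \<open>I\<close> is an interval. The signed
  version is needed: requiring the principal normal of an evolute to be \<open>T\<close> fixes the sign of its
  curvature, which can be negative.\<close>

definition frenet ::
    "real set \<Rightarrow> (real \<Rightarrow> real^3) \<Rightarrow> (real \<Rightarrow> real^3) \<Rightarrow> (real \<Rightarrow> real^3) \<Rightarrow> (real \<Rightarrow> real^3)
      \<Rightarrow> (real \<Rightarrow> real) \<Rightarrow> (real \<Rightarrow> real) \<Rightarrow> bool"
  where "frenet I \<alpha> T N B \<kappa> \<tau> \<longleftrightarrow>
    (\<exists>eT\<in>{-1, 1}. \<exists>eN\<in>{-1, 1}. \<exists>eB\<in>{-1, 1}. eB = - eT * eN \<and>
      (\<forall>s\<in>I.
        lorentz (T s) (T s) = eT \<and> lorentz (N s) (N s) = eN \<and> lorentz (B s) (B s) = eB \<and>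
        lorentz (T s) (N s) = 0 \<and> lorentz (T s) (B s) = 0 \<and> lorentz (N s) (B s) = 0 \<and>
        B s = (eT * eN) *\<^sub>R lorentz_cross (T s) (N s) \<and>
        N s = (eB * eT) *\<^sub>R lorentz_cross (B s) (T s) \<and>
        T s = (eN * eB) *\<^sub>R lorentz_cross (N s) (B s) \<and>
        (\<alpha> has_vector_derivative T s) (at s within I) \<and>
        (T has_vector_derivative \<kappa> s *\<^sub>R N s) (at s within I) \<and>
        (N has_vector_derivative (eB * \<kappa> s) *\<^sub>R T s + \<tau> s *\<^sub>R B s) (at s within I) \<and>
        (B has_vector_derivative (eT * \<tau> s) *\<^sub>R N s) (at s within I) \<and>
        \<kappa> s \<noteq> 0))"

text \<open>A unit speed non-lightlike Frenet curve.\<close>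

definition frenet_curve :: "real set \<Rightarrow> (real \<Rightarrow> real^3) \<Rightarrow> bool"
  where "frenet_curve I \<alpha> \<longleftrightarrow>
    nonlightlike_curve I \<alpha> \<and> unit_speed_curve I \<alpha> \<and> (\<exists>T N B \<kappa> \<tau>. frenet I \<alpha> T N B \<kappa> \<tau>)"

definition unit_field_along ::
    "real set \<Rightarrow> (real \<Rightarrow> real^3) \<Rightarrow> (real \<Rightarrow> real^3) \<Rightarrow> (real \<Rightarrow> real^3) \<Rightarrow> (real \<Rightarrow> real^3) \<Rightarrow> bool"
  where "unit_field_along I T N B X \<longleftrightarrow>
    (\<exists>u v w :: real \<Rightarrow> real.
      u differentiable_on I \<and> v differentiable_on I \<and> w differentiable_on I \<and>
      (\<exists>e\<in>{-1, 1}. \<forall>s\<in>I. lorentz (T s) (T s) * (u s)\<^sup>2 + lorentz (N s) (N s) * (v s)\<^sup>2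
          + lorentz (B s) (B s) * (w s)\<^sup>2 = e) \<and>
      (\<forall>s\<in>I. X s = u s *\<^sub>R T s + v s *\<^sub>R N s + w s *\<^sub>R B s))"

text \<open>\<open>evolute_direction_curve I \<alpha> \<beta>\<close>: the curve \<open>\<beta>\<close> is an evolute-direction curve of \<open>\<alpha>\<close>, that is,
  an \<open>X\<close>-direction curve of \<open>\<alpha>\<close> for some \<open>X\<close> as above (\<open>T' = X\<close>, the primed letters being the Frenet
  data of \<open>\<beta>\<close>) which is an evolute of \<open>\<alpha>\<close> (\<open>\<langle>T', T\<rangle> = 0\<close> and \<open>N' = T\<close>). Comparing coefficients in
  \<open>X' = \<kappa>' T\<close>, differentiation on the left, shows that \<open>X = v N + w B\<close> with \<open>v' = - \<epsilon>\<^sub>T \<tau> w\<close> and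
  \<open>w' = - \<tau> v\<close>. The solutions are, for antiderivatives \<open>\<theta>\<close> of \<open>\<tau>\<close>, the usual expressions
  \<open>- cos \<theta> N + sin \<theta> B\<close> if \<open>\<alpha>\<close> is timelike, and \<open>- cosh \<theta> N + sinh \<theta> B\<close> or \<open>sinh \<theta> N - cosh \<theta> B\<close> if
  \<open>\<alpha>\<close> is spacelike, the latter two up to exchanging the frame \<open>{T, N, B}\<close> with \<open>{T, -N, -B}\<close>.\<close>

definition evolute_direction_curve :: "real set \<Rightarrow> (real \<Rightarrow> real^3) \<Rightarrow> (real \<Rightarrow> real^3) \<Rightarrow> bool"
  where "evolute_direction_curve I \<alpha> \<beta> \<longleftrightarrow>
    frenet_curve I \<alpha> \<and> frenet_curve I \<beta> \<and>
    (\<exists>T N B \<kappa> \<tau> T' N' B' \<kappa>' \<tau>' X.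
      frenet I \<alpha> T N B \<kappa> \<tau> \<and> frenet I \<beta> T' N' B' \<kappa>' \<tau>' \<and>
      unit_field_along I T N B X \<and> (\<forall>s\<in>I. T' s = X s) \<and>
      (\<forall>s\<in>I. lorentz (T' s) (T s) = 0 \<and> N' s = T s))"

definition involute_donor_curve :: "real set \<Rightarrow> (real \<Rightarrow> real^3) \<Rightarrow> (real \<Rightarrow> real^3) \<Rightarrow> bool"
  where "involute_donor_curve I \<beta> \<alpha> \<longleftrightarrow> evolute_direction_curve I \<alpha> \<beta>"

definition helix :: "real set \<Rightarrow> (real \<Rightarrow> real^3) \<Rightarrow> bool"
  where "helix I \<gamma> \<longleftrightarrow> frenet_curve I \<gamma> \<and>
    (\<exists>T N B \<kappa> \<tau>. frenet I \<gamma> T N B \<kappa> \<tau> \<and> (\<forall>s\<in>I. \<kappa> s \<noteq> 0 \<and> \<tau> s \<noteq> 0) \<and>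
      (\<exists>c. \<forall>s\<in>I. \<kappa> s / \<tau> s = c))"

definition plane_curve :: "real set \<Rightarrow> (real \<Rightarrow> real^3) \<Rightarrow> bool"
  where "plane_curve I \<alpha> \<longleftrightarrow> (\<exists>P. affine P \<and> aff_dim P = 2 \<and> \<alpha> ` I \<subseteq> P)"

end

theory Submission
  imports Defs
begin

text \<open>The tangent of an evolute-direction curve of \<open>\<alpha>\<close> is \<open>v N + w B\<close> with \<open>v' = \<epsilon>\<^sub>N \<epsilon>\<^sub>B \<tau> w\<close> and
  \<open>w' = - \<tau> v\<close>, and up to sign its curvature is \<open>\<kappa> v\<close> and its torsion \<open>\<kappa> w\<close>; in particular \<open>v\<close>
  vanishes nowhere. If it is a helix, then \<open>v\<^sup>2 / w\<^sup>2\<close> is constant, hence so is \<open>w\<^sup>2\<close> because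
  \<open>\<epsilon>\<^sub>N v\<^sup>2 + \<epsilon>\<^sub>B w\<^sup>2 = \<plusminus>1\<close>, and differentiation gives \<open>\<tau> v w = 0\<close>, that is, \<open>\<tau> = 0\<close>. Conversely, if
  \<open>\<tau> = 0\<close> then \<open>v\<close> and \<open>w\<close> are constant, but the given evolute-direction curve \<open>\<beta>\<close> may have \<open>w = 0\<close>.
  Since \<open>B\<close> is then constant too, a combination of \<open>\<beta>\<close> and \<open>s B\<close> has tangent \<open>x N + y B\<close> for
  prescribed constants \<open>x\<close>, \<open>y\<close>; choosing both non-zero gives a helix.\<close>

section \<open>Algebra of the Lorentz scalar and vector products\<close>

lemma bounded_bilinear_lorentz: "bounded_bilinear lorentz"
  unfolding bilinear_conv_bounded_bilinear [symmetric]
  by (auto simp: bilinear_def linear_iff lorentz_def algebra_simps)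

interpretation lorentz: bounded_bilinear lorentz
  by (rule bounded_bilinear_lorentz)

lemmas lorentz_simps =
  lorentz.add_left lorentz.add_right lorentz.diff_left lorentz.diff_right
  lorentz.scaleR_left lorentz.scaleR_right lorentz.minus_left lorentz.minus_right
  lorentz.zero_left lorentz.zero_right

lemma lorentz_commute: "lorentz x y = lorentz y x"
  by (simp add: lorentz_def)

lemma bounded_bilinear_lorentz_cross: "bounded_bilinear lorentz_cross"
  unfolding bilinear_conv_bounded_bilinear [symmetric]
  by (auto simp: bilinear_def linear_iff lorentz_cross_def vec_eq_iff forall_3 algebra_simps)

interpretation lorentz_cross: bounded_bilinear lorentz_cross
  by (rule bounded_bilinear_lorentz_cross)

lemma lorentz_cross_skew: "lorentz_cross y x = - lorentz_cross x y"
  by (simp add: lorentz_cross_def vec_eq_iff forall_3)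

lemma lorentz_cross_self: "lorentz_cross x x = 0"
  by (simp add: lorentz_cross_def vec_eq_iff forall_3)

text \<open>The Lorentzian form of the double vector product expansion; both terms carry the
  opposite sign to the Euclidean one. It serves to show that a vector orthogonal to a whole Frenet
  frame vanishes.\<close>

lemma lorentz_cross_cross:
  "lorentz_cross x (lorentz_cross y z) = lorentz x y *\<^sub>R z - lorentz x z *\<^sub>R y"
  by (simp add: lorentz_cross_def lorentz_def vec_eq_iff forall_3 algebra_simps)

text \<open>Multiplication by the Gram matrix diag(-1, 1, 1). It turns Lorentz normals of planes
  into Euclidean normals and back, so that facts on hyperplanes stated with the inner product
  apply.\<close>

definition lorentz_dual :: "real^3 \<Rightarrow> real^3"
  where "lorentz_dual a = vector [- a$1, a$2, a$3]"

lemma lorentz_eq_inner: "lorentz a x = lorentz_dual a \<bullet> x"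
  by (simp add: lorentz_def lorentz_dual_def inner_vec_def sum_3)

lemma lorentz_dual_dual [simp]: "lorentz_dual (lorentz_dual a) = a"
  by (simp add: lorentz_dual_def vec_eq_iff forall_3)

lemma lorentz_dual_eq_0 [simp]: "lorentz_dual a = 0 \<longleftrightarrow> a = 0"
  by (auto simp: lorentz_dual_def vec_eq_iff forall_3)

section \<open>Uniqueness of derivatives within an interval\<close>

text \<open>A connected set with more than one point has no isolated points. This makes derivatives
  within \<open>I\<close> unique, also at end points belonging to \<open>I\<close>.\<close>

lemma interval_at_within_nontrivial:
  fixes I :: "real set"
  assumes "is_interval I" "interior I \<noteq> {}" "s \<in> I"
  shows "at s within I \<noteq> bot"
proof -
  have "I \<noteq> {s}" using assms(2) by auto
  with assms show ?thesis
    using connected_imp_perfect is_interval_connected_1 trivial_limit_within by blast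
qed

text \<open>On \<open>I\<close> the function agrees with a constant, and derivatives within
  \<open>I\<close> are unique at a limit point. This is how identities valid only along
  \<open>I\<close> get differentiated.\<close>

lemma has_vector_derivative_const_on:
  assumes "(f has_vector_derivative D) (at s within I)" "at s within I \<noteq> bot"
    and "s \<in> I" "\<And>x. x \<in> I \<Longrightarrow> f x = c"
  shows "D = 0"
proof -
  have "(f has_vector_derivative 0) (at s within I)"
    by (rule has_vector_derivative_transform [OF assms(3) _ has_vector_derivative_const[of c]])
      (use assms(4) in auto)
  then show ?thesis
    using assms(1,2) vector_derivative_unique_within by blast
qed

section \<open>Frenet frames and their uniqueness\<close>

locale frenet_frame =
  fixes I :: "real set" and \<alpha> T N B :: "real \<Rightarrow> real^3" and \<kappa> \<tau> :: "real \<Rightarrow> real" and eT eN eB :: real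
  assumes signs: "eT = 1 \<or> eT = -1" "eN = 1 \<or> eN = -1" "eB = - eT * eN"
    and TT: "s \<in> I \<Longrightarrow> lorentz (T s) (T s) = eT"
    and NN: "s \<in> I \<Longrightarrow> lorentz (N s) (N s) = eN"
    and BB: "s \<in> I \<Longrightarrow> lorentz (B s) (B s) = eB"
    and TN: "s \<in> I \<Longrightarrow> lorentz (T s) (N s) = 0"
    and TB: "s \<in> I \<Longrightarrow> lorentz (T s) (B s) = 0"
    and NB: "s \<in> I \<Longrightarrow> lorentz (N s) (B s) = 0"
    and B_eq: "s \<in> I \<Longrightarrow> B s = (eT * eN) *\<^sub>R lorentz_cross (T s) (N s)"
    and N_eq: "s \<in> I \<Longrightarrow> N s = (eB * eT) *\<^sub>R lorentz_cross (B s) (T s)"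
    and T_eq: "s \<in> I \<Longrightarrow> T s = (eN * eB) *\<^sub>R lorentz_cross (N s) (B s)"
    and curve_deriv: "s \<in> I \<Longrightarrow> (\<alpha> has_vector_derivative T s) (at s within I)"
    and T_deriv: "s \<in> I \<Longrightarrow> (T has_vector_derivative \<kappa> s *\<^sub>R N s) (at s within I)"
    and N_deriv: "s \<in> I \<Longrightarrow>
      (N has_vector_derivative (eB * \<kappa> s) *\<^sub>R T s + \<tau> s *\<^sub>R B s) (at s within I)"
    and B_deriv: "s \<in> I \<Longrightarrow> (B has_vector_derivative (eT * \<tau> s) *\<^sub>R N s) (at s within I)"
    and curvature_nonzero: "s \<in> I \<Longrightarrow> \<kappa> s \<noteq> 0"
begin

lemma sign_cases: "eT = 1 \<or> eT = -1" "eN = 1 \<or> eN = -1" "eB = 1 \<or> eB = -1"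
  using signs by auto

lemma products:
  assumes "s \<in> I"
  shows "lorentz (T s) (T s) = eT" "lorentz (N s) (N s) = eN" "lorentz (B s) (B s) = eB"
    "lorentz (T s) (N s) = 0" "lorentz (T s) (B s) = 0" "lorentz (N s) (B s) = 0"
    "lorentz (N s) (T s) = 0" "lorentz (B s) (T s) = 0" "lorentz (B s) (N s) = 0"
  using TT[OF assms] NN[OF assms] BB[OF assms] TN[OF assms] TB[OF assms] NB[OF assms]
    lorentz_commute[of "N s" "T s"] lorentz_commute[of "B s" "T s"] lorentz_commute[of "B s" "N s"]
  by auto

text \<open>The sign factors in the frame equations square to 1, so these can be solved for the
  vector products; the other three follow by skew symmetry.\<close>

lemma crosses:
  assumes "s \<in> I"
  shows "lorentz_cross (T s) (N s) = (eT * eN) *\<^sub>R B s" "lorentz_cross (N s) (T s) = - ((eT * eN) *\<^sub>R B s)"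
    "lorentz_cross (B s) (T s) = (eB * eT) *\<^sub>R N s" "lorentz_cross (T s) (B s) = - ((eB * eT) *\<^sub>R N s)"
    "lorentz_cross (N s) (B s) = (eN * eB) *\<^sub>R T s" "lorentz_cross (B s) (N s) = - ((eN * eB) *\<^sub>R T s)"
proof -
  have e: "(eT * eN) * (eT * eN) = 1" "(eB * eT) * (eB * eT) = 1" "(eN * eB) * (eN * eB) = 1"
    using sign_cases by auto
  show TN: "lorentz_cross (T s) (N s) = (eT * eN) *\<^sub>R B s"
    by (simp only: B_eq[OF assms] scaleR_scaleR e scaleR_one)
  show BT: "lorentz_cross (B s) (T s) = (eB * eT) *\<^sub>R N s"
    by (simp only: N_eq[OF assms] scaleR_scaleR e scaleR_one)
  show NB: "lorentz_cross (N s) (B s) = (eN * eB) *\<^sub>R T s"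
    by (simp only: T_eq[OF assms] scaleR_scaleR e scaleR_one)
  show "lorentz_cross (N s) (T s) = - ((eT * eN) *\<^sub>R B s)"
    "lorentz_cross (T s) (B s) = - ((eB * eT) *\<^sub>R N s)"
    "lorentz_cross (B s) (N s) = - ((eN * eB) *\<^sub>R T s)"
    by (simp_all only: TN [symmetric] BT [symmetric] NB [symmetric] lorentz_cross_skew [symmetric])
qed

end

text \<open>One direction gives names to the hidden signs of a given frame; the other certifies the
  frame constructed for the helix.\<close>

lemma frenet_iff_frame: "frenet I \<alpha> T N B \<kappa> \<tau> \<longleftrightarrow> (\<exists>eT eN eB. frenet_frame I \<alpha> T N B \<kappa> \<tau> eT eN eB)"
proof
  assume "frenet I \<alpha> T N B \<kappa> \<tau>"
  then obtain eT eN eB :: real where "eT \<in> {-1, 1}" "eN \<in> {-1, 1}" "eB = - eT * eN"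
    and "\<forall>s\<in>I.
        lorentz (T s) (T s) = eT \<and> lorentz (N s) (N s) = eN \<and> lorentz (B s) (B s) = eB \<and>
        lorentz (T s) (N s) = 0 \<and> lorentz (T s) (B s) = 0 \<and> lorentz (N s) (B s) = 0 \<and>
        B s = (eT * eN) *\<^sub>R lorentz_cross (T s) (N s) \<and>
        N s = (eB * eT) *\<^sub>R lorentz_cross (B s) (T s) \<and>
        T s = (eN * eB) *\<^sub>R lorentz_cross (N s) (B s) \<and>
        (\<alpha> has_vector_derivative T s) (at s within I) \<and>
        (T has_vector_derivative \<kappa> s *\<^sub>R N s) (at s within I) \<and>
        (N has_vector_derivative (eB * \<kappa> s) *\<^sub>R T s + \<tau> s *\<^sub>R B s) (at s within I) \<and>
        (B has_vector_derivative (eT * \<tau> s) *\<^sub>R N s) (at s within I) \<and>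
        \<kappa> s \<noteq> 0"
    unfolding frenet_def by blast
  then have "frenet_frame I \<alpha> T N B \<kappa> \<tau> eT eN eB"
    by unfold_locales blast+
  then show "\<exists>eT eN eB. frenet_frame I \<alpha> T N B \<kappa> \<tau> eT eN eB" by blast
next
  assume "\<exists>eT eN eB. frenet_frame I \<alpha> T N B \<kappa> \<tau> eT eN eB"
  then obtain eT eN eB where *: "frenet_frame I \<alpha> T N B \<kappa> \<tau> eT eN eB" by blast
  from frenet_frame.sign_cases[OF *] have "eT \<in> {-1, 1}" "eN \<in> {-1, 1}" "eB \<in> {-1, 1}" by auto
  with * show "frenet I \<alpha> T N B \<kappa> \<tau>"
    unfolding frenet_def frenet_frame_def by meson
qed

text \<open>The velocity equals \<open>T\<close> by uniqueness of derivatives, and the sign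
  \<open>eT\<close> is the same on all of \<open>I\<close>, so the causal character cannot
  change.\<close>

lemma frenet_imp_frenet_curve:
  assumes nontriv: "\<And>s. s \<in> I \<Longrightarrow> at s within I \<noteq> bot"
    and fr: "frenet I \<alpha> T N B \<kappa> \<tau>"
  shows "frenet_curve I \<alpha>"
proof -
  from fr obtain eT eN eB where "frenet_frame I \<alpha> T N B \<kappa> \<tau> eT eN eB"
    unfolding frenet_iff_frame by blast
  then interpret F: frenet_frame I \<alpha> T N B \<kappa> \<tau> eT eN eB .
  have "velocity I \<alpha> s = T s" if "s \<in> I" for s
    using that F.curve_deriv nontriv vector_derivative_within by blast
  then show ?thesis
    using F.sign_cases(1) F.TT fr unfolding frenet_curve_def nonlightlike_curve_def unit_speed_curve_def
      timelike_def spacelike_def by (elim disjE) (simp_all, blast+)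
qed

text \<open>The frame is unique up to the sign of \<open>N\<close> and \<open>B\<close>, where the sign is a priori allowed to
  depend on the parameter; differentiating \<open>\<langle>N\<^sub>1, B\<^sub>2\<rangle> = 0\<close> shows that this does not affect \<open>\<tau>\<close>.\<close>

lemma frenet_unique:
  assumes nontriv: "\<And>s. s \<in> I \<Longrightarrow> at s within I \<noteq> bot"
    and fr1: "frenet I \<alpha> T1 N1 B1 \<kappa>1 \<tau>1" and fr2: "frenet I \<alpha> T2 N2 B2 \<kappa>2 \<tau>2"
    and s: "s \<in> I"
  shows "(\<kappa>1 s)\<^sup>2 = (\<kappa>2 s)\<^sup>2" "\<tau>1 s = \<tau>2 s"
proof -
  from fr1 obtain eT eN eB where "frenet_frame I \<alpha> T1 N1 B1 \<kappa>1 \<tau>1 eT eN eB"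
    unfolding frenet_iff_frame by blast
  then interpret F: frenet_frame I \<alpha> T1 N1 B1 \<kappa>1 \<tau>1 eT eN eB .
  note e = F.sign_cases F.signs(3) and f = F.products
  from fr2 obtain eT' eN' eB' where "frenet_frame I \<alpha> T2 N2 B2 \<kappa>2 \<tau>2 eT' eN' eB'"
    unfolding frenet_iff_frame by blast
  then interpret G: frenet_frame I \<alpha> T2 N2 B2 \<kappa>2 \<tau>2 eT' eN' eB' .
  note e' = G.sign_cases G.signs(3) and f' = G.products
  have T: "T2 x = T1 x" if "x \<in> I" for x
    using F.curve_deriv[OF that] G.curve_deriv[OF that] nontriv[OF that] vector_derivative_unique_within by blast
  have eT': "eT' = eT"
    using F.TT[OF s] G.TT[OF s] T[OF s] by simp
  have kN: "\<kappa>2 x *\<^sub>R N2 x = \<kappa>1 x *\<^sub>R N1 x" if "x \<in> I" for x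
  proof -
    have "(T1 has_vector_derivative \<kappa>2 x *\<^sub>R N2 x) (at x within I)"
      by (rule has_vector_derivative_transform [OF that _ G.T_deriv[OF that]]) (simp add: T)
    then show ?thesis
      using F.T_deriv[OF that] nontriv[OF that] vector_derivative_unique_within by blast
  qed
  have sq: "(\<kappa>2 x)\<^sup>2 * eN' = (\<kappa>1 x)\<^sup>2 * eN" if "x \<in> I" for x
    using arg_cong[OF kN[OF that], of "\<lambda>z. lorentz z z"] F.NN[OF that] G.NN[OF that]
    by (simp add: lorentz_simps power2_eq_square)
  \<comment> \<open>Both curvatures have positive squares, so \<open>sq\<close> forces equal
    signs.\<close>
  have eN': "eN' = eN"
  proof -
    have "(\<kappa>1 s)\<^sup>2 > 0" "(\<kappa>2 s)\<^sup>2 > 0" using F.curvature_nonzero[OF s] G.curvature_nonzero[OF s] by auto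
    with e(2) e'(2) sq[OF s] show ?thesis by (elim disjE) simp_all
  qed
  show "(\<kappa>1 s)\<^sup>2 = (\<kappa>2 s)\<^sup>2"
    using sq[OF s] e(2) eN' by auto
  \<comment> \<open>By the equality of squares, \<open>\<sigma> x\<close> is 1 or -1. It is only
    used pointwise and never differentiated, so no regularity of it is required.\<close>
  define \<sigma> where "\<sigma> x = \<kappa>1 x / \<kappa>2 x" for x
  have N2: "N2 x = \<sigma> x *\<^sub>R N1 x" if "x \<in> I" for x
  proof -
    have "N2 x = (1 / \<kappa>2 x) *\<^sub>R (\<kappa>2 x *\<^sub>R N2 x)" using G.curvature_nonzero[OF that] by simp
    then show ?thesis by (simp add: kN[OF that] \<sigma>_def)
  qed
  have B2: "B2 x = \<sigma> x *\<^sub>R B1 x" if "x \<in> I" for x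
    using F.B_eq[OF that] G.B_eq[OF that] N2[OF that] T[OF that] eT' eN'
    by (simp add: lorentz_cross.scaleR_right)
  have "((\<lambda>x. lorentz (N1 x) (B2 x)) has_vector_derivative
      lorentz (N1 s) ((eT' * \<tau>2 s) *\<^sub>R N2 s)
      + lorentz ((eB * \<kappa>1 s) *\<^sub>R T1 s + \<tau>1 s *\<^sub>R B1 s) (B2 s)) (at s within I)"
    by (rule lorentz.has_vector_derivative[OF F.N_deriv[OF s] G.B_deriv[OF s]])
  then have "lorentz (N1 s) ((eT' * \<tau>2 s) *\<^sub>R N2 s)
      + lorentz ((eB * \<kappa>1 s) *\<^sub>R T1 s + \<tau>1 s *\<^sub>R B1 s) (B2 s) = 0"
    by (rule has_vector_derivative_const_on[OF _ nontriv[OF s] s, where c = 0])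
      (simp add: B2 F.products lorentz_simps)
  then have "\<sigma> s * (eT * eN * \<tau>2 s + eB * \<tau>1 s) = 0"
    by (simp add: N2[OF s] B2[OF s] lorentz_simps F.products[OF s] eT' algebra_simps)
  moreover have "\<sigma> s \<noteq> 0" using F.curvature_nonzero[OF s] G.curvature_nonzero[OF s] by (simp add: \<sigma>_def)
  ultimately show "\<tau>1 s = \<tau>2 s" using e by auto
qed

section \<open>Plane curves and vanishing torsion\<close>

text \<open>Planes in 3-space are hyperplanes, and the Lorentz product is nondegenerate, so every
  plane has a Lorentz normal.\<close>

lemma plane_curve_iff_lorentz:
  "plane_curve I \<alpha> \<longleftrightarrow> (\<exists>a c. a \<noteq> 0 \<and> (\<forall>s\<in>I. lorentz a (\<alpha> s) = c))"
proof
  assume "plane_curve I \<alpha>"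
  then obtain P where P: "affine P" "aff_dim P = 2" "\<alpha> ` I \<subseteq> P"
    unfolding plane_curve_def by blast
  then obtain a b where "a \<noteq> 0" "P = {x. a \<bullet> x = b}"
    using aff_dim_eq_hyperplane[of P] hull_same[of affine P] by auto
  with P(3) have "lorentz_dual a \<noteq> 0 \<and> (\<forall>s\<in>I. lorentz (lorentz_dual a) (\<alpha> s) = b)"
    by (auto simp: lorentz_eq_inner)
  then show "\<exists>a c. a \<noteq> 0 \<and> (\<forall>s\<in>I. lorentz a (\<alpha> s) = c)" by blast
next
  assume "\<exists>a c. a \<noteq> 0 \<and> (\<forall>s\<in>I. lorentz a (\<alpha> s) = c)"
  then obtain a c where a: "a \<noteq> 0" "\<forall>s\<in>I. lorentz a (\<alpha> s) = c" by blast
  let ?P = "{x. lorentz_dual a \<bullet> x = c}"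
  have "affine ?P" by (rule affine_hyperplane)
  moreover have "aff_dim ?P = 2" using a(1) by (simp add: aff_dim_hyperplane)
  moreover have "\<alpha> ` I \<subseteq> ?P" using a(2) by (auto simp: lorentz_eq_inner)
  ultimately show "plane_curve I \<alpha>" unfolding plane_curve_def by blast
qed

text \<open>Differentiating the equation of the plane three times makes its normal \<open>a\<close>
  orthogonal to \<open>T\<close>, then to \<open>N\<close>, and gives
  \<open>\<tau> s * lorentz a (B s) = 0\<close>. Conversely, without torsion \<open>B\<close> is
  constant and is itself a normal of the plane.\<close>

lemma plane_curve_iff_torsion_zero:
  assumes "is_interval I" "interior I \<noteq> {}"
    and fr: "frenet I \<alpha> T N B \<kappa> \<tau>"
  shows "plane_curve I \<alpha> \<longleftrightarrow> (\<forall>s\<in>I. \<tau> s = 0)"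
proof -
  note nontriv = interval_at_within_nontrivial[OF assms(1,2)]
  from fr obtain eT eN eB where "frenet_frame I \<alpha> T N B \<kappa> \<tau> eT eN eB"
    unfolding frenet_iff_frame by blast
  then interpret F: frenet_frame I \<alpha> T N B \<kappa> \<tau> eT eN eB .
  note e = F.sign_cases F.signs(3) and f = F.products
  have eB: "eB \<noteq> 0" using e by auto
  show ?thesis
  proof
    assume "plane_curve I \<alpha>"
    then obtain a c where a: "a \<noteq> 0" "\<And>s. s \<in> I \<Longrightarrow> lorentz a (\<alpha> s) = c"
      unfolding plane_curve_iff_lorentz by blast
    have deriv: "((\<lambda>x. lorentz a (f x)) has_vector_derivative lorentz a D) (at s within I)"
      if "(f has_vector_derivative D) (at s within I)" for f D s
      by (rule bounded_linear.has_vector_derivative[OF lorentz.bounded_linear_right that])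
    have aT: "lorentz a (T s) = 0" if "s \<in> I" for s
      using has_vector_derivative_const_on[OF deriv[OF F.curve_deriv] nontriv] that a(2) by blast
    have "lorentz a (\<kappa> s *\<^sub>R N s) = 0" if "s \<in> I" for s
      using has_vector_derivative_const_on[OF deriv[OF F.T_deriv] nontriv] that aT by blast
    then have aN: "lorentz a (N s) = 0" if "s \<in> I" for s
      using that F.curvature_nonzero by (auto simp: lorentz_simps)
    have aN': "lorentz a ((eB * \<kappa> s) *\<^sub>R T s + \<tau> s *\<^sub>R B s) = 0" if "s \<in> I" for s
      using has_vector_derivative_const_on[OF deriv[OF F.N_deriv] nontriv] that aN by blast
    show "\<forall>s\<in>I. \<tau> s = 0"
    proof
      fix s assume s: "s \<in> I"
      \<comment> \<open>Otherwise \<open>a\<close> is orthogonal to the whole frame. As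
        \<open>B\<close> is a multiple of \<open>T\<close> cross \<open>N\<close>, expanding gives
        \<open>a\<close> cross \<open>B\<close> = 0, and a second expansion leaves
        \<open>eB *\<^sub>R a = 0\<close>.\<close>
      have "lorentz a (B s) \<noteq> 0"
      proof
        assume aB: "lorentz a (B s) = 0"
        have "lorentz_cross a (B s) = 0"
          using F.B_eq[OF s] aT[OF s] aN[OF s]
          by (simp add: lorentz_cross.scaleR_right lorentz_cross_cross)
        then have "lorentz_cross (B s) (lorentz_cross a (B s)) = 0"
          by (simp add: lorentz_cross.zero_right)
        then have "eB *\<^sub>R a = 0"
          using aB F.BB[OF s] by (simp add: lorentz_cross_cross lorentz_commute)
        with eB a(1) show False by simp
      qed
      with aN'[OF s] aT[OF s] show "\<tau> s = 0" by (simp add: lorentz_simps)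
    qed
  next
    assume \<tau>: "\<forall>s\<in>I. \<tau> s = 0"
    have convex: "convex I" using assms(1) by (rule is_interval_convex)
    have "(B has_vector_derivative 0) (at s within I)" if "s \<in> I" for s
      using F.B_deriv[OF that] \<tau> that by simp
    then obtain b where b: "\<And>s. s \<in> I \<Longrightarrow> B s = b"
      using has_vector_derivative_zero_constant[OF convex, of B] by blast
    have "((\<lambda>x. lorentz b (\<alpha> x)) has_vector_derivative 0) (at s within I)" if "s \<in> I" for s
      using bounded_linear.has_vector_derivative[OF lorentz.bounded_linear_right F.curve_deriv[OF that], of b]
        F.TB[OF that] b[OF that] by (simp add: lorentz_commute)
    then obtain c where c: "\<And>s. s \<in> I \<Longrightarrow> lorentz b (\<alpha> s) = c"
      using has_vector_derivative_zero_constant[OF convex, of "\<lambda>x. lorentz b (\<alpha> x)"] by blast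
    obtain s where "s \<in> I" using assms(2) interior_subset by blast
    then have "b \<noteq> 0" using F.BB b eB by (auto simp: lorentz_simps)
    with c show "plane_curve I \<alpha>" unfolding plane_curve_iff_lorentz by blast
  qed
qed

section \<open>Frenet data of an evolute-direction curve\<close>

text \<open>Since \<open>N'\<close> is \<open>T\<close>, the derivative of \<open>T'\<close> is
  \<open>\<kappa>'\<close> times \<open>T\<close>, hence orthogonal to \<open>N\<close> and
  \<open>B\<close>; only the torsion of \<open>\<alpha>\<close> drives the coefficients
  \<open>v\<close> and \<open>w\<close>. The last two formulas are squared so that sign factors drop
  out.\<close>

lemma evolute_tangent:
  assumes nontriv: "\<And>s. s \<in> I \<Longrightarrow> at s within I \<noteq> bot"
    and fr: "frenet I \<alpha> T N B \<kappa> \<tau>" and fr': "frenet I \<beta> T' N' B' \<kappa>' \<tau>'"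
    and X: "unit_field_along I T N B X" "\<And>s. s \<in> I \<Longrightarrow> T' s = X s"
    and ev: "\<And>s. s \<in> I \<Longrightarrow> lorentz (T' s) (T s) = 0" "\<And>s. s \<in> I \<Longrightarrow> N' s = T s"
  obtains v w :: "real \<Rightarrow> real" and eN eB e :: real
  where "eN = 1 \<or> eN = -1" "eB = 1 \<or> eB = -1" "e = 1 \<or> e = -1"
    and "\<And>s. s \<in> I \<Longrightarrow> T' s = v s *\<^sub>R N s + w s *\<^sub>R B s"
    and "\<And>s. s \<in> I \<Longrightarrow> eN * (v s)\<^sup>2 + eB * (w s)\<^sup>2 = e"
    and "\<And>s. s \<in> I \<Longrightarrow> (v has_vector_derivative eN * eB * \<tau> s * w s) (at s within I)"
    and "\<And>s. s \<in> I \<Longrightarrow> (w has_vector_derivative - (\<tau> s * v s)) (at s within I)"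
    and "\<And>s. s \<in> I \<Longrightarrow> v s \<noteq> 0"
    and "\<And>s. s \<in> I \<Longrightarrow> (\<kappa>' s)\<^sup>2 = (\<kappa> s)\<^sup>2 * (v s)\<^sup>2"
    and "\<And>s. s \<in> I \<Longrightarrow> (\<tau>' s)\<^sup>2 = (\<kappa> s)\<^sup>2 * (w s)\<^sup>2"
proof -
  from fr obtain eT eN eB where "frenet_frame I \<alpha> T N B \<kappa> \<tau> eT eN eB"
    unfolding frenet_iff_frame by blast
  then interpret F: frenet_frame I \<alpha> T N B \<kappa> \<tau> eT eN eB .
  note e = F.sign_cases F.signs(3) and f = F.products
  from fr' obtain eT' eN' eB' where "frenet_frame I \<beta> T' N' B' \<kappa>' \<tau>' eT' eN' eB'"
    unfolding frenet_iff_frame by blast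
  then interpret G: frenet_frame I \<beta> T' N' B' \<kappa>' \<tau>' eT' eN' eB' .
  note e' = G.sign_cases G.signs(3) and f' = G.products
  \<comment> \<open>The coefficients are expressed by scalar products, whose derivatives the Frenet
    equations supply; they are matched with those of \<open>X\<close> pointwise.\<close>
  define v where "v s = eN * lorentz (T' s) (N s)" for s
  define w where "w s = eB * lorentz (T' s) (B s)" for s
  have T': "T' s = v s *\<^sub>R N s + w s *\<^sub>R B s" if s: "s \<in> I" for s
  proof -
    obtain a b c where abc: "T' s = a *\<^sub>R T s + b *\<^sub>R N s + c *\<^sub>R B s"
      using X s unfolding unit_field_along_def by metis
    have "a = 0"
      using ev(1)[OF s] e f[OF s] by (auto simp: abc lorentz_simps)
    moreover have "v s = b" "w s = c"
      using e f[OF s] by (auto simp: v_def w_def abc lorentz_simps)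
    ultimately show ?thesis using abc by simp
  qed
  have unit: "eN * (v s)\<^sup>2 + eB * (w s)\<^sup>2 = eT'" if s: "s \<in> I" for s
    using G.TT[OF s] f[OF s] by (simp add: T'[OF s] lorentz_simps power2_eq_square mult_ac)
  have dv: "(v has_vector_derivative eN * eB * \<tau> s * w s) (at s within I)" if s: "s \<in> I" for s
  proof -
    have "((\<lambda>x. eN * lorentz (T' x) (N x)) has_vector_derivative
        eN * (lorentz (T' s) ((eB * \<kappa> s) *\<^sub>R T s + \<tau> s *\<^sub>R B s) + lorentz (\<kappa>' s *\<^sub>R N' s) (N s)))
        (at s within I)"
      by (rule has_vector_derivative_mult_right lorentz.has_vector_derivative G.T_deriv[OF s] F.N_deriv[OF s])+
    then show ?thesis
      using f[OF s] ev(2)[OF s] unfolding v_def[symmetric]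
      by (simp add: T'[OF s] lorentz_simps algebra_simps)
  qed
  have dw: "(w has_vector_derivative - (\<tau> s * v s)) (at s within I)" if s: "s \<in> I" for s
  proof -
    have "((\<lambda>x. eB * lorentz (T' x) (B x)) has_vector_derivative
        eB * (lorentz (T' s) ((eT * \<tau> s) *\<^sub>R N s) + lorentz (\<kappa>' s *\<^sub>R N' s) (B s)))
        (at s within I)"
      by (rule has_vector_derivative_mult_right lorentz.has_vector_derivative G.T_deriv[OF s] F.B_deriv[OF s])+
    moreover have "eB * (lorentz (T' s) ((eT * \<tau> s) *\<^sub>R N s) + lorentz (\<kappa>' s *\<^sub>R N' s) (B s))
        = - (\<tau> s * v s)"
      using f[OF s] ev(2)[OF s] e by (auto simp: T'[OF s] lorentz_simps)
    ultimately show ?thesis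
      unfolding w_def[symmetric] by simp
  qed
  \<comment> \<open>Obtained by differentiating the orthogonality of \<open>T'\<close> and
    \<open>T\<close>; as \<open>\<kappa>'\<close> has no zeros, neither has
    \<open>v\<close>.\<close>
  have curv: "\<kappa>' s * eT + \<kappa> s * eN * v s = 0" if s: "s \<in> I" for s
  proof -
    have "((\<lambda>x. lorentz (T' x) (T x)) has_vector_derivative
        lorentz (T' s) (\<kappa> s *\<^sub>R N s) + lorentz (\<kappa>' s *\<^sub>R N' s) (T s)) (at s within I)"
      by (rule lorentz.has_vector_derivative G.T_deriv[OF s] F.T_deriv[OF s])+
    then have "lorentz (T' s) (\<kappa> s *\<^sub>R N s) + lorentz (\<kappa>' s *\<^sub>R N' s) (T s) = 0"
      by (rule has_vector_derivative_const_on[OF _ nontriv[OF s] s]) (rule ev(1))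
    then show ?thesis
      using f[OF s] ev(2)[OF s] by (simp add: T'[OF s] lorentz_simps mult_ac)
  qed
  have v0: "v s \<noteq> 0" if s: "s \<in> I" for s
    using curv[OF s] G.curvature_nonzero[OF s] e by auto
  have \<kappa>2: "(\<kappa>' s)\<^sup>2 = (\<kappa> s)\<^sup>2 * (v s)\<^sup>2" if s: "s \<in> I" for s
  proof -
    have "\<kappa>' s = \<kappa> s * v s \<or> \<kappa>' s = - (\<kappa> s * v s)" using curv[OF s] e by auto
    then show ?thesis by (auto simp: power_mult_distrib)
  qed
  \<comment> \<open>The derivative of \<open>N' = T\<close> is given by the Frenet equations of
    either curve. Comparing the Lorentz squares of the two expressions and inserting
    \<open>\<kappa>2\<close> and \<open>unit\<close> isolates the square of
    \<open>\<tau>'\<close>.\<close>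
  have \<tau>2: "(\<tau>' s)\<^sup>2 = (\<kappa> s)\<^sup>2 * (w s)\<^sup>2" if s: "s \<in> I" for s
  proof -
    have "(N' has_vector_derivative \<kappa> s *\<^sub>R N s) (at s within I)"
      by (rule has_vector_derivative_transform [OF s _ F.T_deriv[OF s]]) (simp add: ev)
    then have "(eB' * \<kappa>' s) *\<^sub>R T' s + \<tau>' s *\<^sub>R B' s = \<kappa> s *\<^sub>R N s"
      using G.N_deriv[OF s] nontriv[OF s] vector_derivative_unique_within by blast
    from arg_cong[OF this, of "\<lambda>z. lorentz z z"]
    have "eB' * eB' * eT' * (\<kappa>' s)\<^sup>2 + eB' * (\<tau>' s)\<^sup>2 = eN * (\<kappa> s)\<^sup>2"
      using f'[OF s] f[OF s] by (simp add: lorentz_simps power2_eq_square algebra_simps)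
    moreover have "eN' = eT" using G.NN[OF s] F.TT[OF s] ev(2)[OF s] by simp
    moreover have "(\<kappa> s)\<^sup>2 * (eN * (v s)\<^sup>2 + eB * (w s)\<^sup>2) = (\<kappa> s)\<^sup>2 * eT'"
      using unit[OF s] by simp
    ultimately show ?thesis
      using e e' \<kappa>2[OF s] by (auto simp: algebra_simps)
  qed
  show thesis
    by (rule that[of eN eB eT' v w]) (use e e' T' unit dv dw v0 \<kappa>2 \<tau>2 in auto)
qed

section \<open>Helices among the evolute-direction curves\<close>

lemma helix_evolute_imp_plane:
  assumes "is_interval I" "interior I \<noteq> {}"
    and ev: "evolute_direction_curve I \<alpha> \<gamma>" and hel: "helix I \<gamma>"
  shows "plane_curve I \<alpha>"
proof -
  note nontriv = interval_at_within_nontrivial[OF assms(1,2)]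
  from ev obtain T N B \<kappa> \<tau> T' N' B' \<kappa>' \<tau>' X where fr: "frenet I \<alpha> T N B \<kappa> \<tau>"
    and fr': "frenet I \<gamma> T' N' B' \<kappa>' \<tau>'"
    and X: "unit_field_along I T N B X" "\<And>s. s \<in> I \<Longrightarrow> T' s = X s"
    and ev: "\<And>s. s \<in> I \<Longrightarrow> lorentz (T' s) (T s) = 0" "\<And>s. s \<in> I \<Longrightarrow> N' s = T s"
    unfolding evolute_direction_curve_def by metis
  from hel obtain T2 N2 B2 \<kappa>2 \<tau>2 c where fr2: "frenet I \<gamma> T2 N2 B2 \<kappa>2 \<tau>2"
    and nz: "\<And>s. s \<in> I \<Longrightarrow> \<kappa>2 s \<noteq> 0 \<and> \<tau>2 s \<noteq> 0"
    and c: "\<And>s. s \<in> I \<Longrightarrow> \<kappa>2 s / \<tau>2 s = c"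
    unfolding helix_def by blast
  obtain v w :: "real \<Rightarrow> real" and eN eB e :: real
  where e: "e = 1 \<or> e = -1"
    and unit: "\<And>s. s \<in> I \<Longrightarrow> eN * (v s)\<^sup>2 + eB * (w s)\<^sup>2 = e"
    and dw: "\<And>s. s \<in> I \<Longrightarrow> (w has_vector_derivative - (\<tau> s * v s)) (at s within I)"
    and v0: "\<And>s. s \<in> I \<Longrightarrow> v s \<noteq> 0"
    and \<kappa>': "\<And>s. s \<in> I \<Longrightarrow> (\<kappa>' s)\<^sup>2 = (\<kappa> s)\<^sup>2 * (v s)\<^sup>2"
    and \<tau>': "\<And>s. s \<in> I \<Longrightarrow> (\<tau>' s)\<^sup>2 = (\<kappa> s)\<^sup>2 * (w s)\<^sup>2"
    by (rule evolute_tangent[OF nontriv fr fr' X ev]) blast+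
  have w0: "w s \<noteq> 0 \<and> (v s)\<^sup>2 = c\<^sup>2 * (w s)\<^sup>2" if s: "s \<in> I" for s
  proof -
    \<comment> \<open>The frame witnessing the helix need not be the one witnessing the evolute;
      uniqueness carries the constant ratio over, up to sign.\<close>
    have "(\<kappa>' s)\<^sup>2 = (\<kappa>2 s)\<^sup>2" "\<tau>' s = \<tau>2 s"
      by (rule frenet_unique[OF nontriv fr' fr2 s]; assumption)+
    moreover from c[OF s] nz[OF s] have "\<kappa>2 s = c * \<tau>2 s" by (simp add: field_simps)
    ultimately have "(\<kappa>' s)\<^sup>2 = c\<^sup>2 * (\<tau>' s)\<^sup>2" "\<tau>' s \<noteq> 0"
      using nz[OF s] by (simp_all add: power_mult_distrib)
    with \<kappa>'[OF s] \<tau>'[OF s] show ?thesis by auto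
  qed
  have unit': "(eN * c\<^sup>2 + eB) * (w s)\<^sup>2 = e" if s: "s \<in> I" for s
    using unit[OF s] w0[OF s] by (simp add: algebra_simps)
  have "\<tau> s = 0" if s: "s \<in> I" for s
  proof -
    \<comment> \<open>Its product with the square of \<open>w\<close> is 1 or -1, so one may divide
      by it and the square of \<open>w\<close> is constant.\<close>
    have k: "eN * c\<^sup>2 + eB \<noteq> 0" using unit'[OF s] e by auto
    have "((\<lambda>x. w x * w x) has_vector_derivative w s * - (\<tau> s * v s) + - (\<tau> s * v s) * w s)
        (at s within I)"
      by (rule has_vector_derivative_mult[OF dw[OF s] dw[OF s]])
    then have "w s * - (\<tau> s * v s) + - (\<tau> s * v s) * w s = 0"
      by (rule has_vector_derivative_const_on[OF _ nontriv[OF s] s, where c = "e / (eN * c\<^sup>2 + eB)"])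
        (use unit' k in \<open>simp add: eq_divide_eq power2_eq_square mult.commute\<close>)
    then show ?thesis using w0[OF s] v0[OF s] by simp
  qed
  then show ?thesis using plane_curve_iff_torsion_zero[OF assms(1,2) fr] by blast
qed

lemma plane_imp_helix_evolute:
  assumes "is_interval I" "interior I \<noteq> {}"
    and ev: "evolute_direction_curve I \<alpha> \<beta>" and plane: "plane_curve I \<alpha>"
  shows "\<exists>\<gamma>. evolute_direction_curve I \<alpha> \<gamma> \<and> helix I \<gamma>"
proof -
  note nontriv = interval_at_within_nontrivial[OF assms(1,2)]
  have convex: "convex I" using assms(1) by (rule is_interval_convex)
  obtain s0 where s0: "s0 \<in> I" using assms(2) interior_subset by blast
  from ev obtain T N B \<kappa> \<tau> T' N' B' \<kappa>' \<tau>' X where fr: "frenet I \<alpha> T N B \<kappa> \<tau>"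
    and fr': "frenet I \<beta> T' N' B' \<kappa>' \<tau>'"
    and X: "unit_field_along I T N B X" "\<And>s. s \<in> I \<Longrightarrow> T' s = X s"
    and ev': "\<And>s. s \<in> I \<Longrightarrow> lorentz (T' s) (T s) = 0" "\<And>s. s \<in> I \<Longrightarrow> N' s = T s"
    unfolding evolute_direction_curve_def by metis
  have \<tau>: "\<And>s. s \<in> I \<Longrightarrow> \<tau> s = 0"
    using plane plane_curve_iff_torsion_zero[OF assms(1,2) fr] by blast
  obtain v w :: "real \<Rightarrow> real" and eN' eB' :: real
  where T': "\<And>s. s \<in> I \<Longrightarrow> T' s = v s *\<^sub>R N s + w s *\<^sub>R B s"
    and dv: "\<And>s. s \<in> I \<Longrightarrow> (v has_vector_derivative eN' * eB' * \<tau> s * w s) (at s within I)"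
    and dw: "\<And>s. s \<in> I \<Longrightarrow> (w has_vector_derivative - (\<tau> s * v s)) (at s within I)"
    and v0: "\<And>s. s \<in> I \<Longrightarrow> v s \<noteq> 0"
    by (rule evolute_tangent[OF nontriv fr fr' X ev']) blast+
  have "(v has_vector_derivative 0) (at s within I)" "(w has_vector_derivative 0) (at s within I)"
    if "s \<in> I" for s using dv[OF that] dw[OF that] \<tau>[OF that] by simp_all
  then obtain p q where p: "\<And>s. s \<in> I \<Longrightarrow> v s = p" and q: "\<And>s. s \<in> I \<Longrightarrow> w s = q"
    using has_vector_derivative_zero_constant[OF convex, of v]
      has_vector_derivative_zero_constant[OF convex, of w] by metis
  have p0: "p \<noteq> 0" using p v0 s0 by metis
  from fr obtain eT eN eB where "frenet_frame I \<alpha> T N B \<kappa> \<tau> eT eN eB"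
    unfolding frenet_iff_frame by blast
  then interpret F: frenet_frame I \<alpha> T N B \<kappa> \<tau> eT eN eB .
  note e = F.sign_cases F.signs(3) and f = F.products
  have dN0: "(N has_vector_derivative (eB * \<kappa> s) *\<^sub>R T s) (at s within I)" if "s \<in> I" for s
    using F.N_deriv[OF that] \<tau>[OF that] by simp
  have dB0: "(B has_vector_derivative 0) (at s within I)" if "s \<in> I" for s
    using F.B_deriv[OF that] \<tau>[OF that] by simp
  then obtain b where b: "\<And>s. s \<in> I \<Longrightarrow> B s = b"
    using has_vector_derivative_zero_constant[OF convex, of B] by blast
  have d\<beta>: "(\<beta> has_vector_derivative p *\<^sub>R N s + q *\<^sub>R b) (at s within I)" if s: "s \<in> I" for s
  proof -
    have "(\<beta> has_vector_derivative T' s) (at s within I)"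
      using fr' s unfolding frenet_def by blast
    then show ?thesis using T'[OF s] p[OF s] q[OF s] b[OF s] by simp
  qed
  \<comment> \<open>Both coefficients must be non-zero and the resulting tangent a unit vector. The
    3-4-5 triangle provides rational points on the circle and, for opposite signs, on the
    hyperbola.\<close>
  obtain x y :: real where x0: "x \<noteq> 0" and y0: "y \<noteq> 0"
    and "eN * x\<^sup>2 + eB * y\<^sup>2 = 1 \<or> eN * x\<^sup>2 + eB * y\<^sup>2 = - 1"
  proof (cases "eN = eB")
    case True
    show thesis
      by (rule that[of "3/5" "4/5"]) (use True e in \<open>auto simp: power2_eq_square\<close>)
  next
    case False
    show thesis
      by (rule that[of "5/3" "4/3"]) (use False e in \<open>auto simp: power2_eq_square\<close>)
  qed
  then obtain d where d: "d = eN * x\<^sup>2 + eB * y\<^sup>2" "d = 1 \<or> d = -1" by blast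
  \<comment> \<open>Scaling \<open>\<beta>\<close> by \<open>x / p\<close> turns the normal
    component \<open>p\<close> of its tangent into \<open>x\<close>; the linear term corrects the
    binormal component from \<open>x / p * q\<close> to \<open>y\<close>.\<close>
  define \<gamma> where "\<gamma> s = (x / p) *\<^sub>R \<beta> s + s *\<^sub>R ((y - x / p * q) *\<^sub>R b)" for s
  define T2 where "T2 s = x *\<^sub>R N s + y *\<^sub>R B s" for s
  \<comment> \<open>The principal normal of \<open>\<gamma>\<close> has to be \<open>T\<close>, so
    \<open>B2\<close> is \<open>d * eT\<close> times the vector product of \<open>T2\<close> and
    \<open>T\<close>. The curvature and torsion below are read off from the derivatives of
    \<open>T2\<close> and \<open>B2\<close> with \<open>\<tau>\<close> = 0.\<close>
  define B2 where "B2 s = (d * eB * y) *\<^sub>R N s - (d * eN * x) *\<^sub>R B s" for s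
  define \<kappa>2 where "\<kappa>2 s = eB * x * \<kappa> s" for s
  define \<tau>2 where "\<tau>2 s = y * \<kappa> s" for s
  have d\<gamma>: "(\<gamma> has_vector_derivative T2 s) (at s within I)" if s: "s \<in> I" for s
    unfolding \<gamma>_def T2_def b[OF s]
    by (rule derivative_eq_intros d\<beta>[OF s] refl)+ (use p0 in \<open>simp add: algebra_simps\<close>)
  have "frenet_frame I \<gamma> T2 T B2 \<kappa>2 \<tau>2 d eT (- d * eT)"
  proof unfold_locales
    show "d = 1 \<or> d = - 1" "eT = 1 \<or> eT = - 1" "- d * eT = - d * eT" using d(2) e by auto
    fix s assume s: "s \<in> I"
    have dd: "d * d = 1" using d(2) by auto
    have eNB: "eN * eB = - eT" using e by auto
    note cr = F.crosses[OF s]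
    note bil = lorentz_cross.add_left lorentz_cross.add_right lorentz_cross.diff_left
       lorentz_cross.diff_right lorentz_cross.scaleR_left lorentz_cross.scaleR_right
       lorentz_cross_self
    show "lorentz (T2 s) (T2 s) = d"
      using f[OF s] by (simp add: T2_def d lorentz_simps power2_eq_square)
    show "lorentz (T s) (T s) = eT" by (rule f[OF s])
    show "lorentz (B2 s) (B2 s) = - d * eT"
    proof -
      have "lorentz (B2 s) (B2 s) = d * d * (eN * eB * (eN * x\<^sup>2 + eB * y\<^sup>2))"
        using f[OF s] e(1-3) by (elim disjE) (simp_all add: B2_def lorentz_simps power2_eq_square algebra_simps)
      then show ?thesis by (simp only: d(1) [symmetric] dd eNB) simp
    qed
    show "lorentz (T2 s) (T s) = 0"
      using f[OF s] by (simp add: T2_def lorentz_simps)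
    show "lorentz (T2 s) (B2 s) = 0"
      using f[OF s] e by (auto simp: T2_def B2_def lorentz_simps)
    show "lorentz (T s) (B2 s) = 0"
      using f[OF s] by (simp add: B2_def lorentz_simps)
    show "B2 s = (d * eT) *\<^sub>R lorentz_cross (T2 s) (T s)"
      using e by (auto simp: B2_def T2_def bil cr algebra_simps)
    show "T s = (- d * eT * d) *\<^sub>R lorentz_cross (B2 s) (T2 s)"
    proof -
      have "lorentz_cross (B2 s) (T2 s) = (d * (eN * eB * (eN * x\<^sup>2 + eB * y\<^sup>2))) *\<^sub>R T s"
        unfolding B2_def T2_def bil cr
        using e(1-3) by (elim disjE) (simp_all add: power2_eq_square algebra_simps)
      then have "lorentz_cross (B2 s) (T2 s) = (- eT) *\<^sub>R T s"
        using dd by (simp only: d(1) [symmetric] eNB) (simp add: mult_ac)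
      then show ?thesis using e d(2) by auto
    qed
    show "T2 s = (eT * (- d * eT)) *\<^sub>R lorentz_cross (T s) (B2 s)"
      unfolding B2_def T2_def bil cr
      using e d(2) by (elim disjE) (simp_all add: algebra_simps)
    show "(\<gamma> has_vector_derivative T2 s) (at s within I)" by (rule d\<gamma>[OF s])
    show "(T2 has_vector_derivative \<kappa>2 s *\<^sub>R T s) (at s within I)"
      unfolding T2_def \<kappa>2_def
      by (rule derivative_eq_intros dN0[OF s] dB0[OF s] refl)+ (simp add: algebra_simps)
    show "(T has_vector_derivative (- d * eT * \<kappa>2 s) *\<^sub>R T2 s + \<tau>2 s *\<^sub>R B2 s) (at s within I)"
    proof -
      \<comment> \<open>The \<open>B\<close> components cancel because
        \<open>eT * eB = - eN\<close>; the factor left on \<open>N\<close> is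
        \<open>\<kappa> s * d * d\<close>, which is \<open>\<kappa> s\<close>.\<close>
      have "(- d * eT * \<kappa>2 s) *\<^sub>R T2 s + \<tau>2 s *\<^sub>R B2 s =
          (\<kappa> s * d * (eN * x\<^sup>2 + eB * y\<^sup>2)) *\<^sub>R N s"
        using e by (auto simp: \<kappa>2_def \<tau>2_def T2_def B2_def power2_eq_square algebra_simps)
      then show ?thesis using F.T_deriv[OF s] dd by (simp flip: d(1) add: mult.assoc)
    qed
    show "(B2 has_vector_derivative (d * \<tau>2 s) *\<^sub>R T s) (at s within I)"
      unfolding B2_def \<tau>2_def
      by (rule derivative_eq_intros dN0[OF s] dB0[OF s] refl)+ (use e in auto)
    show "\<kappa>2 s \<noteq> 0"
      using F.curvature_nonzero[OF s] x0 e by (auto simp: \<kappa>2_def)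
  qed
  then have fr2: "frenet I \<gamma> T2 T B2 \<kappa>2 \<tau>2"
    unfolding frenet_iff_frame by blast
  have curve: "frenet_curve I \<gamma>"
    by (rule frenet_imp_frenet_curve[OF nontriv fr2])
  have field: "unit_field_along I T N B T2"
    unfolding unit_field_along_def
  proof (intro exI conjI bexI ballI)
    show "(\<lambda>_. 0) differentiable_on I" "(\<lambda>_. x) differentiable_on I" "(\<lambda>_. y) differentiable_on I"
      by simp_all
    show "d \<in> {-1, 1}" using d(2) by auto
  qed (simp_all add: f d T2_def)
  have orth: "\<forall>s\<in>I. lorentz (T2 s) (T s) = 0 \<and> T s = T s"
    using f by (simp add: T2_def lorentz_simps)
  have "frenet_curve I \<alpha>" using ev by (simp add: evolute_direction_curve_def)
  then have "evolute_direction_curve I \<alpha> \<gamma>"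
    unfolding evolute_direction_curve_def using curve fr fr2 field orth by blast
  moreover have "helix I \<gamma>"
  proof -
    have "\<forall>s\<in>I. \<kappa>2 s \<noteq> 0 \<and> \<tau>2 s \<noteq> 0" "\<forall>s\<in>I. \<kappa>2 s / \<tau>2 s = eB * x / y"
      using F.curvature_nonzero x0 y0 e by (auto simp: \<kappa>2_def \<tau>2_def)
    then show ?thesis unfolding helix_def using curve fr2 by blast
  qed
  ultimately show ?thesis by blast
qed

theorem theorem3p4:
  fixes I :: "real set" and \<alpha> \<beta> :: "real \<Rightarrow> real^3"
  assumes "is_interval I" and "interior I \<noteq> {}"
    and "frenet_curve I \<alpha>"
    and "frenet_curve I \<beta>"
    and "evolute_direction_curve I \<alpha> \<beta>"
  shows "(plane_curve I \<alpha> \<longleftrightarrow> (\<exists>\<gamma>. helix I \<gamma> \<and> involute_donor_curve I \<gamma> \<alpha>)) \<and>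
    ((\<exists>\<gamma>. helix I \<gamma> \<and> involute_donor_curve I \<gamma> \<alpha>) \<longleftrightarrow>
      (\<exists>\<gamma>. evolute_direction_curve I \<alpha> \<gamma> \<and> helix I \<gamma>))"
  \<comment> \<open>After unfolding, (ii) and (iii) differ only in the order of a conjunction. The
    curve \<open>\<beta>\<close> is the starting point for constructing the helix when
    \<open>\<alpha>\<close> is plane.\<close>
  unfolding involute_donor_curve_def
  using plane_imp_helix_evolute[OF assms(1,2,5)] helix_evolute_imp_plane[OF assms(1,2)]
  by blast

end
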